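(* Let $n$ be a composite positive integer and let $G$ be a group of order $n$. Then $$\alpha\bigl(\Theta(G)\bigr)\geq \max\bigl\{|I_d(G)| : d\in SP(n)\bigr\}.$$
   Context: For a finite group $G$, $|g|$ denotes the order of $g\in G$. The prime-coprime graph $\Theta(G)$ is the simple graph with vertex set $G$ in which two distinct vertices $g,h$ are adjacent if and only if $\gcd(|g|,|h|)$ is either $1$ or a prime. A semiprime is a product of two (possibly equal) primes. $SP(n)$ is the set of semiprime divisors of $n$, and for $d\in SP(n)$, $I_d(G)=\{g\in G : d \text{ divides } |g|\}$. The independence number $\alpha(\Gamma)$ of a graph $\Gamma$ is the maximum cardinality of an independent set of $\Gamma$. *)

theory Defs
  imports
    "HOL-Algebra.Multiplicative_Group"
    "Graph_Theory.Pair_Digraph"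
    "HOL-Computational_Algebra.Primes"
begin

text \<open>
  Simple graphs are the symmetric, loop-free digraphs without parallel arcs of the theory
  \<^theory>\<open>Graph_Theory.Pair_Digraph\<close> (locale \<^locale>\<open>pair_graph\<close>): an edge between
  \<open>u\<close> and \<open>v\<close> is the pair of arcs \<open>(u, v)\<close> and \<open>(v, u)\<close>.
\<close>

definition independent_set :: "'a pair_pre_digraph \<Rightarrow> 'a set \<Rightarrow> bool" where
  "independent_set \<Gamma> S \<longleftrightarrow>
     S \<subseteq> pverts \<Gamma> \<and> (\<forall>u\<in>S. \<forall>v\<in>S. (u, v) \<notin> parcs \<Gamma>)"

text \<open>
  The maximum below is meaningful for finite graphs only; the empty set is always independent.
\<close>

definition independence_number :: "'a pair_pre_digraph \<Rightarrow> nat" where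
  "independence_number \<Gamma> = Max {card S | S. independent_set \<Gamma> S}"

definition prime_coprime_graph :: "('a, 'b) monoid_scheme \<Rightarrow> 'a pair_pre_digraph" where
  "prime_coprime_graph G =
     \<lparr> pverts = carrier G,
       parcs = {(g, h). g \<in> carrier G \<and> h \<in> carrier G \<and> g \<noteq> h \<and>
         (gcd (group.ord G g) (group.ord G h) = 1 \<or>
          Factorial_Ring.prime (gcd (group.ord G g) (group.ord G h)))} \<rparr>"

lemma prime_coprime_graph_is_pair_graph:
  assumes "finite (carrier G)"
  shows "pair_graph (prime_coprime_graph G)"
proof unfold_locales
  show "finite (parcs (prime_coprime_graph G))"
    by (rule finite_subset[of _ "carrier G \<times> carrier G"])
      (use assms in \<open>auto simp: prime_coprime_graph_def\<close>)
qed (use assms in \<open>auto simp: prime_coprime_graph_def symmetric_def sym_def gcd.commute\<close>)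

definition semiprime :: "nat \<Rightarrow> bool" where
  "semiprime m \<longleftrightarrow>
     (\<exists>p q. Factorial_Ring.prime p \<and> Factorial_Ring.prime q \<and> m = p * q)"

definition SP :: "nat \<Rightarrow> nat set" where
  "SP n = {d. semiprime d \<and> d dvd n}"

definition I_set :: "('a, 'b) monoid_scheme \<Rightarrow> nat \<Rightarrow> 'a set" where
  "I_set G d = {g \<in> carrier G. d dvd group.ord G g}"


definition composite :: "nat \<Rightarrow> bool" where
  "composite n \<longleftrightarrow> n > 1 \<and> \<not> Factorial_Ring.prime n"

end

theory Submission
  imports Defs
begin

text \<open>If a semiprime \<open>d\<close> divides the orders of both \<open>g\<close> and
  \<open>h\<close>, it divides their gcd, which is then neither 1 nor a prime
  (\<open>not_semiprime_dvd_one_or_prime\<close>). Hence no two elements of \<open>I_set G d\<close>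
  are adjacent (\<open>independent_set_I_set\<close>), and the independence number bounds the size
  of each such set. Compositeness of \<open>n\<close> makes \<open>SP n\<close> nonempty, so the
  maximum of these sizes is attained and obeys the same bound.\<close>

text \<open>Write \<open>d = p * q\<close>. A prime \<open>r\<close> divisible by \<open>p\<close>
  equals \<open>p\<close>, and then \<open>p * q dvd p\<close> would force
  \<open>q = 1\<close>.\<close>

lemma not_semiprime_dvd_one_or_prime:
  assumes "semiprime d" and "d dvd r"
  shows "r \<noteq> 1 \<and> \<not> Factorial_Ring.prime r"
proof -
  from assms(1) obtain p q :: nat
    where p: "Factorial_Ring.prime p" and q: "Factorial_Ring.prime q" and d: "d = p * q"
    unfolding semiprime_def by blast
  have p1: "p > 1" and q1: "q > 1"
    using prime_gt_1_nat p q by blast+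
  have False if r: "Factorial_Ring.prime r"
  proof -
    have "p dvd r"
      using assms(2) d dvd_mult_left by blast
    then have "p = r"
      using p r primes_dvd_imp_eq by blast
    with assms(2) d p1 show False
      using q1 by auto
  qed
  moreover have "r \<noteq> 1"
    using assms(2) d p1 by auto
  ultimately show ?thesis by blast
qed

lemma independent_set_I_set:
  assumes "semiprime d"
  shows "independent_set (prime_coprime_graph G) (I_set G d)"
  using not_semiprime_dvd_one_or_prime[OF assms]
  unfolding independent_set_def prime_coprime_graph_def I_set_def
  by (auto simp del: One_nat_def)

text \<open>Finiteness of the vertex set bounds the possible cardinalities, so \<open>Max\<close> is
  a genuine maximum here.\<close>

lemma card_le_independence_number:
  assumes "finite (pverts \<Gamma>)" and "independent_set \<Gamma> S"
  shows "card S \<le> independence_number \<Gamma>"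
proof -
  have "{card S | S. independent_set \<Gamma> S} \<subseteq> card ` Pow (pverts \<Gamma>)"
    by (auto simp: independent_set_def)
  then have "finite {card S | S. independent_set \<Gamma> S}"
    by (rule finite_subset) (use assms(1) in simp)
  then show ?thesis
    unfolding independence_number_def using assms(2) by (intro Max_ge) auto
qed

text \<open>Split off a prime factor \<open>p\<close>; since \<open>n\<close> is not prime, the
  cofactor differs from 1 and has a prime factor of its own, possibly \<open>p\<close>
  again.\<close>

lemma SP_nonempty:
  assumes "composite n"
  shows "SP n \<noteq> {}"
proof -
  from assms have n: "n > 1" "\<not> Factorial_Ring.prime n"
    by (auto simp: composite_def)
  obtain p where p: "Factorial_Ring.prime p" "p dvd n"
    using n(1) prime_factor_nat[of n] by auto
  then obtain m where m: "n = p * m" by blast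
  with n(2) p(1) have "m \<noteq> 1" by auto
  then obtain q where q: "Factorial_Ring.prime q" "q dvd m"
    using prime_factor_nat by blast
  have "p * q \<in> SP n"
    unfolding SP_def semiprime_def using p(1) q m by auto
  then show ?thesis by blast
qed

lemma finite_SP:
  assumes "n > 0"
  shows "finite (SP n)"
  by (rule finite_subset[of _ "{d. d dvd n}"]) (use assms in \<open>auto simp: SP_def\<close>)

theorem proposition3p5:
  fixes G :: "('a, 'b) monoid_scheme" and n :: nat
  assumes "composite n" and "group G" and "order G = n"
  shows "independence_number (prime_coprime_graph G) \<ge> Max {card (I_set G d) | d. d \<in> SP n}"
proof -
  have n: "n > 0"
    using assms(1) by (simp add: composite_def)
  \<comment> \<open>\<open>order\<close> is the cardinality of the carrier, which defaults to 0 on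
    infinite sets; a positive order therefore forces finiteness.\<close>
  then have "finite (carrier G)"
    using assms(3) card_ge_0_finite unfolding order_def by blast
  then have "finite (pverts (prime_coprime_graph G))"
    by (simp add: prime_coprime_graph_def)
  then have "card (I_set G d) \<le> independence_number (prime_coprime_graph G)" if "d \<in> SP n" for d
    using that by (intro card_le_independence_number independent_set_I_set) (simp_all add: SP_def)
  then show ?thesis
    \<comment> \<open>As an image of \<open>SP n\<close>, the set of cardinalities is finite and
      nonempty, so bounding its \<open>Max\<close> amounts to bounding each member.\<close>
    unfolding setcompr_eq_image using finite_SP[OF n] SP_nonempty[OF assms(1)]
    by (subst Max_le_iff) auto
qed

end
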